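(* There is a computable function $\kappa : \mathbb{N} \to \mathbb{N}$ such that for every $n \in \mathbb{N}$ the following multivalued map $\operatorname{Zero}_{n \min} :\subseteq \mathcal{C}([0,1],\mathbb{R}) \rightrightarrows [0,1]^{\kappa(n)}$ is computable: its domain consists of those continuous $f : [0,1]\to\mathbb{R}$ which have at most $n$ local minima and satisfy $f(0)\neq 0 \neq f(1)$, and $(x_1,\ldots,x_{\kappa(n)}) \in \operatorname{Zero}_{n\min}(f)$ iff for every $x \in [0,1]$ with $f(x) = 0$ there is some $i$ with $x_i = x$.
   Context: $\mathcal{C}([0,1],\mathbb{R})$ is the space of continuous real functions on $[0,1]$ with its standard representation (as in computable analysis); $[0,1]^k$ carries the standard Cauchy representation. A multivalued map is computable if some computable function on names maps every name of an input to a name of some admissible output. Local extrema are understood so as to exclude plateaux. *)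

theory Defs
  imports "HOL-Analysis.Analysis" "HOL-Library.Nat_Bijection"
begin

text \<open>Kleene-style partial recursive functions on nat (unary, using Cantor pairing),
  relative to an oracle p :: nat => nat (the name of the input).\<close>

datatype rf = RZero | RSucc | RId | RFst | RSnd | ROracle
  | RComp rf rf | RPair rf rf | RPrimRec rf rf | RMu rf

inductive rf_eval :: "(nat \<Rightarrow> nat) \<Rightarrow> rf \<Rightarrow> nat \<Rightarrow> nat \<Rightarrow> bool" where
  "rf_eval p RZero x 0"
| "rf_eval p RSucc x (Suc x)"
| "rf_eval p RId x x"
| "rf_eval p RFst x (fst (prod_decode x))"
| "rf_eval p RSnd x (snd (prod_decode x))"
| "rf_eval p ROracle x (p x)"
| "rf_eval p g x y \<Longrightarrow> rf_eval p f y z \<Longrightarrow> rf_eval p (RComp f g) x z"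
| "rf_eval p f x a \<Longrightarrow> rf_eval p g x b \<Longrightarrow> rf_eval p (RPair f g) x (prod_encode (a, b))"
| "rf_eval p f x y \<Longrightarrow> rf_eval p (RPrimRec f g) (prod_encode (x, 0)) y"
| "rf_eval p (RPrimRec f g) (prod_encode (x, k)) y \<Longrightarrow>
   rf_eval p g (prod_encode (x, prod_encode (k, y))) z \<Longrightarrow>
   rf_eval p (RPrimRec f g) (prod_encode (x, Suc k)) z"
| "rf_eval p f (prod_encode (x, n)) 0 \<Longrightarrow>
   (\<forall>m<n. \<exists>v. v \<noteq> 0 \<and> rf_eval p f (prod_encode (x, m)) v) \<Longrightarrow>
   rf_eval p (RMu f) x n"

definition computable_nat_fun :: "(nat \<Rightarrow> nat) \<Rightarrow> bool" where
  "computable_nat_fun g \<longleftrightarrow> (\<exists>e. \<forall>n. rf_eval (\<lambda>_. 0) e n (g n))"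

text \<open>Represented spaces: a representation is a relation "p is a name of x".
  A multivalued map F with domain D is computable w.r.t. representations
  delta_in, delta_out if some oracle machine maps every name of an input x in D
  (total output) to a name of some admissible output y in F x.\<close>
definition computable_mv ::
  "((nat \<Rightarrow> nat) \<Rightarrow> 'a \<Rightarrow> bool) \<Rightarrow> ((nat \<Rightarrow> nat) \<Rightarrow> 'b \<Rightarrow> bool) \<Rightarrow>
   'a set \<Rightarrow> ('a \<Rightarrow> 'b set) \<Rightarrow> bool" where
  "computable_mv din dout D F \<longleftrightarrow>
     (\<exists>e. \<forall>p x. x \<in> D \<and> din p x \<longrightarrow>
        (\<exists>q. (\<forall>k. rf_eval p e k (q k)) \<and> (\<exists>y. y \<in> F x \<and> dout q y)))"

definition rat_of_code :: "nat \<Rightarrow> real" where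
  "rat_of_code n = (case prod_decode n of (a, b) \<Rightarrow> real_of_int (int_decode a) / real (Suc b))"

definition cauchy_rep_cube :: "nat \<Rightarrow> (nat \<Rightarrow> nat) \<Rightarrow> real list \<Rightarrow> bool" where
  "cauchy_rep_cube k q xs \<longleftrightarrow> length xs = k \<and> set xs \<subseteq> {0..1} \<and>
     (\<forall>i<k. \<forall>m. \<bar>rat_of_code (q (prod_encode (i, m))) - xs ! i\<bar> \<le> (1/2) ^ m)"

definition rat_poly_of_code :: "nat \<Rightarrow> real \<Rightarrow> real" where
  "rat_poly_of_code c x = (let cs = list_decode c in
      \<Sum>i<length cs. rat_of_code (cs ! i) * x ^ i)"

definition cfun_rep :: "(nat \<Rightarrow> nat) \<Rightarrow> (real \<Rightarrow> real) \<Rightarrow> bool" where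
  "cfun_rep p f \<longleftrightarrow> continuous_on {0..1} f \<and>
     (\<forall>m. \<forall>x\<in>{0..1}. \<bar>f x - rat_poly_of_code (p m) x\<bar> \<le> (1/2) ^ m)"

text \<open>Local minimum of f on [0,1] (non-strict, relative to [0,1]); a plateau thus
  yields infinitely many local minima and is excluded by finiteness.\<close>
definition local_min_01 :: "(real \<Rightarrow> real) \<Rightarrow> real \<Rightarrow> bool" where
  "local_min_01 f x \<longleftrightarrow> x \<in> {0..1} \<and>
     (\<exists>\<epsilon>>0. \<forall>y\<in>{0..1}. \<bar>y - x\<bar> < \<epsilon> \<longrightarrow> f x \<le> f y)"

definition zero_nmin_dom :: "nat \<Rightarrow> (real \<Rightarrow> real) set" where
  "zero_nmin_dom n = {f. continuous_on {0..1} f \<and>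
      finite {x. local_min_01 f x} \<and> card {x. local_min_01 f x} \<le> n \<and>
      f 0 \<noteq> 0 \<and> f 1 \<noteq> 0}"

definition zero_nmin :: "nat \<Rightarrow> (real \<Rightarrow> real) \<Rightarrow> real list set" where
  "zero_nmin k f = {xs. length xs = k \<and> set xs \<subseteq> {0..1} \<and>
      (\<forall>x\<in>{0..1}. f x = 0 \<longrightarrow> (\<exists>i<k. xs ! i = x))}"

end

theory Submission
  imports Defs
begin

text \<open>If \<open>f\<close> has at most \<open>n\<close> local minima, then \<open>|f|\<close> has at most \<open>2(n + 1)\<close> of them, and every
  zero of \<open>f\<close> is one. Search for zeros in an interval whose endpoints are no zeros,
  excluding subintervals from the left and from the right as soon as \<open>f\<close> is seen to be nonzero there.
  The remaining interval shrinks to a point unless both of its limit endpoints are zeros. In that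
  case one finds a point \<open>c\<close> such that \<open>|f|\<close> has a strict valley, hence a local minimum, on either
  side of \<open>c\<close>. The search continues on one side of \<open>c\<close> only. At most \<open>2(n + 1)\<close> such choices are
  possible, so running the search for every binary word of this length captures all zeros.\<close>

section \<open>Uniformly computable functions\<close>

abbreviation pfst :: "nat \<Rightarrow> nat" where "pfst n \<equiv> fst (prod_decode n)"
abbreviation psnd :: "nat \<Rightarrow> nat" where "psnd n \<equiv> snd (prod_decode n)"

text \<open>One program \<open>e\<close> has to serve all oracles \<open>p\<close> and be total for
  each of them; this uniformity lets the pieces be assembled into a single machine acting on
  names.\<close>

definition cmp :: "((nat \<Rightarrow> nat) \<Rightarrow> nat \<Rightarrow> nat) \<Rightarrow> bool" where
  "cmp F \<longleftrightarrow> (\<exists>e. \<forall>p x. rf_eval p e x (F p x))"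

lemma cmp_id: "cmp (\<lambda>p x. x)"
  unfolding cmp_def by (blast intro: rf_eval.intros)

lemma cmp_comp1:
  assumes "\<And>p x. rf_eval p e x (h p x)" "cmp f"
  shows "cmp (\<lambda>p x. h p (f p x))"
  using assms unfolding cmp_def by (blast intro: rf_eval.intros)

lemma cmp_Suc: "cmp f \<Longrightarrow> cmp (\<lambda>p x. Suc (f p x))"
  by (rule cmp_comp1[where e = RSucc]) (auto intro: rf_eval.intros)

lemma cmp_pfst: "cmp f \<Longrightarrow> cmp (\<lambda>p x. pfst (f p x))"
  by (rule cmp_comp1[where e = RFst]) (auto intro: rf_eval.intros)

lemma cmp_psnd: "cmp f \<Longrightarrow> cmp (\<lambda>p x. psnd (f p x))"
  by (rule cmp_comp1[where e = RSnd]) (auto intro: rf_eval.intros)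

lemma cmp_oracle: "cmp f \<Longrightarrow> cmp (\<lambda>p x. p (f p x))"
  by (rule cmp_comp1[where e = ROracle]) (auto intro: rf_eval.intros)

lemma cmp_const: "cmp (\<lambda>p x. n)"
proof (induction n)
  case 0
  show ?case unfolding cmp_def by (blast intro: rf_eval.intros)
qed (rule cmp_Suc)

lemma cmp_pair: "cmp f \<Longrightarrow> cmp g \<Longrightarrow> cmp (\<lambda>p x. prod_encode (f p x, g p x))"
  unfolding cmp_def by (blast intro: rf_eval.intros)

lemma cmp_compose:
  assumes "cmp F" "cmp g"
  shows "cmp (\<lambda>p x. F p (g p x))"
  using assms unfolding cmp_def by (blast intro: rf_eval.intros)

text \<open>\<open>RPrimRec\<close> hands its step program the code of \<open>(x, (k, y))\<close>.
  Hence the premise on \<open>g\<close> decodes three arguments from one number, with the parameter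
  \<open>x\<close> among them.\<close>

lemma cmp_rec:
  assumes "cmp a" "cmp (\<lambda>p z. g p (pfst z) (pfst (psnd z)) (psnd (psnd z)))" "cmp n"
  shows "cmp (\<lambda>p x. rec_nat (a p x) (g p x) (n p x))"
proof -
  obtain ea where ea: "\<And>p x. rf_eval p ea x (a p x)"
    using assms(1) unfolding cmp_def by blast
  obtain eg where
    eg: "\<And>p z. rf_eval p eg z (g p (pfst z) (pfst (psnd z)) (psnd (psnd z)))"
    using assms(2) unfolding cmp_def by blast
  obtain en where en: "\<And>p x. rf_eval p en x (n p x)"
    using assms(3) unfolding cmp_def by blast
  have rec: "rf_eval p (RPrimRec ea eg) (prod_encode (x, k)) (rec_nat (a p x) (g p x) k)" for p x k
  proof (induction k)
    case 0
    show ?case using ea by (auto intro: rf_eval.intros)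
  next
    case (Suc k)
    have "rf_eval p eg (prod_encode (x, prod_encode (k, rec_nat (a p x) (g p x) k)))
        (rec_nat (a p x) (g p x) (Suc k))"
      using eg[of p "prod_encode (x, prod_encode (k, rec_nat (a p x) (g p x) k))"] by simp
    with Suc show ?case by (rule rf_eval.intros)
  qed
  have "rf_eval p (RComp (RPrimRec ea eg) (RPair RId en)) x (rec_nat (a p x) (g p x) (n p x))"
    for p x
    by (rule rf_eval.intros(7)[OF rf_eval.intros(8)[OF rf_eval.intros(3) en] rec])
  then show ?thesis unfolding cmp_def by blast
qed

lemma cmp_add:
  assumes "cmp f" "cmp g"
  shows "cmp (\<lambda>p x. f p x + g p x)"
proof -
  have "rec_nat a (\<lambda>k. Suc) n = a + n" for a n by (induction n) auto
  moreover have "cmp (\<lambda>p x. rec_nat (f p x) (\<lambda>k. Suc) (g p x))"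
    by (intro cmp_rec[where g = "\<lambda>p x k. Suc"] assms cmp_Suc cmp_psnd cmp_id)
  ultimately show ?thesis by simp
qed

lemma cmp_pred:
  assumes "cmp f"
  shows "cmp (\<lambda>p x. f p x - Suc 0)"
proof -
  have "rec_nat 0 (\<lambda>k y. k) n = n - Suc 0" for n by (induction n) auto
  moreover have "cmp (\<lambda>p x. rec_nat 0 (\<lambda>k y. k) (f p x))"
    by (intro cmp_rec[where g = "\<lambda>p x k y. k"] assms cmp_const cmp_pfst cmp_psnd cmp_id)
  ultimately show ?thesis by simp
qed

lemma cmp_diff:
  assumes "cmp f" "cmp g"
  shows "cmp (\<lambda>p x. f p x - g p x)"
proof -
  have "rec_nat a (\<lambda>k y. y - Suc 0) n = a - n" for a n by (induction n) auto
  moreover have "cmp (\<lambda>p x. rec_nat (f p x) (\<lambda>k y. y - Suc 0) (g p x))"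
    by (intro cmp_rec[where g = "\<lambda>p x k y. y - Suc 0"] assms cmp_pred cmp_psnd cmp_id)
  ultimately show ?thesis by simp
qed

lemma cmp_mult:
  assumes "cmp f" "cmp g"
  shows "cmp (\<lambda>p x. f p x * g p x)"
proof -
  have "rec_nat 0 (\<lambda>k y. y + a) n = a * n" for a n by (induction n) auto
  moreover have "cmp (\<lambda>p x. rec_nat 0 (\<lambda>k y. y + f p x) (g p x))"
    by (intro cmp_rec[where g = "\<lambda>p x k y. y + f p x"] assms cmp_const cmp_add
        cmp_compose[OF assms(1)] cmp_pfst cmp_psnd cmp_id)
  ultimately show ?thesis by simp
qed

lemma cmp_power:
  assumes "cmp f" "cmp g"
  shows "cmp (\<lambda>p x. f p x ^ g p x)"
proof -
  have "rec_nat 1 (\<lambda>k y. y * a) n = a ^ n" for a n :: nat by (induction n) auto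
  moreover have "cmp (\<lambda>p x. rec_nat 1 (\<lambda>k y. y * f p x) (g p x))"
    by (intro cmp_rec[where g = "\<lambda>p x k y. y * f p x"] assms cmp_const cmp_mult
        cmp_compose[OF assms(1)] cmp_pfst cmp_psnd cmp_id)
  ultimately show ?thesis by simp
qed

lemma cmp_mod2:
  assumes "cmp f"
  shows "cmp (\<lambda>p x. f p x mod 2)"
proof -
  have "rec_nat 0 (\<lambda>k y. 1 - y) n = n mod 2" for n
    by (induction n) (auto simp: mod_Suc)
  moreover have "cmp (\<lambda>p x. rec_nat 0 (\<lambda>k y. 1 - y) (f p x))"
    by (intro cmp_rec[where g = "\<lambda>p x k y. 1 - y"] assms cmp_const cmp_diff cmp_psnd cmp_id)
  ultimately show ?thesis by simp
qed

lemma cmp_div2: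
  assumes "cmp f"
  shows "cmp (\<lambda>p x. f p x div 2)"
proof -
  \<comment> \<open>The quotient grows from \<open>k\<close> to \<open>Suc k\<close> exactly when
    \<open>k\<close> is odd.\<close>
  have "rec_nat 0 (\<lambda>k y. y + k mod 2) n = n div 2" for n
    by (induction n) (auto, presburger)
  moreover have "cmp (\<lambda>p x. rec_nat 0 (\<lambda>k y. y + k mod 2) (f p x))"
    by (intro cmp_rec[where g = "\<lambda>p x k y. y + k mod 2"] assms cmp_const cmp_add cmp_mod2
        cmp_pfst cmp_psnd cmp_id)
  ultimately show ?thesis by simp
qed

lemmas cmp_arith = cmp_id cmp_const cmp_Suc cmp_pfst cmp_psnd cmp_oracle cmp_pair cmp_add cmp_diff
  cmp_mult cmp_power cmp_mod2 cmp_div2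

section \<open>Decidable predicates and exact rational arithmetic\<close>

definition dcmp :: "((nat \<Rightarrow> nat) \<Rightarrow> nat \<Rightarrow> bool) \<Rightarrow> bool" where
  "dcmp P \<longleftrightarrow> cmp (\<lambda>p x. of_bool (P p x))"

lemma cmp_if:
  assumes "dcmp P" "cmp f" "cmp g"
  shows "cmp (\<lambda>p x. if P p x then f p x else g p x)"
proof -
  have "cmp (\<lambda>p x. of_bool (P p x) * f p x + (1 - of_bool (P p x)) * g p x)"
    by (intro cmp_arith assms assms(1)[unfolded dcmp_def])
  moreover have "of_bool b * u + (1 - of_bool b) * v = (if b then u else v)" for b and u v :: nat
    by simp
  ultimately show ?thesis by simp
qed

lemma dcmp_conj:
  assumes "dcmp P" "dcmp Q"
  shows "dcmp (\<lambda>p x. P p x \<and> Q p x)"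
  using cmp_mult[OF assms[unfolded dcmp_def]] unfolding dcmp_def of_bool_conj .

lemma dcmp_not:
  assumes "dcmp P"
  shows "dcmp (\<lambda>p x. \<not> P p x)"
proof -
  have "cmp (\<lambda>p x. 1 - of_bool (P p x))"
    by (intro cmp_arith assms[unfolded dcmp_def])
  moreover have "of_bool (\<not> b) = 1 - (of_bool b :: nat)" for b by simp
  ultimately show ?thesis unfolding dcmp_def by simp
qed

lemma dcmp_less:
  assumes "cmp f" "cmp g"
  shows "dcmp (\<lambda>p x. f p x < g p x)"
proof -
  have "cmp (\<lambda>p x. 1 - (1 - (g p x - f p x)))"
    by (intro cmp_arith assms)
  moreover have "1 - (1 - (b - a)) = (of_bool (a < b) :: nat)" for a b :: nat
    by simp
  ultimately show ?thesis unfolding dcmp_def by simp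
qed

lemma dcmp_eq:
  assumes "cmp f" "cmp g"
  shows "dcmp (\<lambda>p x. f p x = g p x)"
proof -
  have "dcmp (\<lambda>p x. \<not> f p x < g p x \<and> \<not> g p x < f p x)"
    by (intro dcmp_conj dcmp_not dcmp_less assms)
  moreover have "(\<not> a < b \<and> \<not> b < a) = (a = b)" for a b :: nat by auto
  ultimately show ?thesis by simp
qed

text \<open>Rational values as unreduced fractions of natural number functions. The difference
  \<open>U - V\<close> in the numerator takes care of signs without integer codes.\<close>

definition rcmp :: "((nat \<Rightarrow> nat) \<Rightarrow> nat \<Rightarrow> real) \<Rightarrow> bool" where
  "rcmp F \<longleftrightarrow> (\<exists>U V D. cmp U \<and> cmp V \<and> cmp D \<and>
     (\<forall>p x. D p x > 0 \<and> F p x = (real (U p x) - real (V p x)) / real (D p x)))"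

lemma rcmpI:
  assumes "cmp U" "cmp V" "cmp D" "\<And>p x. D p x > 0"
    "\<And>p x. F p x = (real (U p x) - real (V p x)) / real (D p x)"
  shows "rcmp F"
  using assms unfolding rcmp_def by blast

lemma rcmpE:
  assumes "rcmp F"
  obtains U V D where "cmp U" "cmp V" "cmp D" "\<And>p x. D p x > 0"
    "\<And>p x. F p x = (real (U p x) - real (V p x)) / real (D p x)"
  using assms unfolding rcmp_def by blast

lemma rcmp_of_nat: "cmp f \<Longrightarrow> rcmp (\<lambda>p x. real (f p x))"
  by (rule rcmpI[where U = f and V = "\<lambda>p x. 0" and D = "\<lambda>p x. 1"])
    (simp_all add: cmp_const)

lemma rcmp_add:
  assumes "rcmp F" "rcmp G"
  shows "rcmp (\<lambda>p x. F p x + G p x)"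
proof -
  obtain U V D where F: "cmp U" "cmp V" "cmp D" "\<And>p x. D p x > 0"
    "\<And>p x. F p x = (real (U p x) - real (V p x)) / real (D p x)"
    using assms(1) by (rule rcmpE) (rule that)
  obtain U' V' D' where G: "cmp U'" "cmp V'" "cmp D'" "\<And>p x. D' p x > 0"
    "\<And>p x. G p x = (real (U' p x) - real (V' p x)) / real (D' p x)"
    using assms(2) by (rule rcmpE) (rule that)
  show ?thesis
    by (rule rcmpI[where U = "\<lambda>p x. U p x * D' p x + U' p x * D p x"
          and V = "\<lambda>p x. V p x * D' p x + V' p x * D p x" and D = "\<lambda>p x. D p x * D' p x"])
      (use F G in \<open>auto intro!: cmp_add cmp_mult simp: add_frac_eq less_imp_neq[symmetric] algebra_simps\<close>)
qed

lemma rcmp_mult: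
  assumes "rcmp F" "rcmp G"
  shows "rcmp (\<lambda>p x. F p x * G p x)"
proof -
  obtain U V D where F: "cmp U" "cmp V" "cmp D" "\<And>p x. D p x > 0"
    "\<And>p x. F p x = (real (U p x) - real (V p x)) / real (D p x)"
    using assms(1) by (rule rcmpE) (rule that)
  obtain U' V' D' where G: "cmp U'" "cmp V'" "cmp D'" "\<And>p x. D' p x > 0"
    "\<And>p x. G p x = (real (U' p x) - real (V' p x)) / real (D' p x)"
    using assms(2) by (rule rcmpE) (rule that)
  show ?thesis
    by (rule rcmpI[where U = "\<lambda>p x. U p x * U' p x + V p x * V' p x"
          and V = "\<lambda>p x. U p x * V' p x + V p x * U' p x" and D = "\<lambda>p x. D p x * D' p x"])
      (use F G in \<open>auto intro!: cmp_add cmp_mult simp: algebra_simps\<close>)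
qed

lemma rcmp_diff:
  assumes "rcmp F" "rcmp G"
  shows "rcmp (\<lambda>p x. F p x - G p x)"
proof -
  obtain U V D where G: "cmp U" "cmp V" "cmp D" "\<And>p x. D p x > 0"
    "\<And>p x. G p x = (real (U p x) - real (V p x)) / real (D p x)"
    using assms(2) by (rule rcmpE) (rule that)
  have "rcmp (\<lambda>p x. - G p x)"
    by (rule rcmpI[where U = V and V = U and D = D])
      (use G in \<open>auto simp: minus_divide_left\<close>)
  from rcmp_add[OF assms(1) this] show ?thesis by simp
qed

lemma rcmp_abs:
  assumes "rcmp F"
  shows "rcmp (\<lambda>p x. \<bar>F p x\<bar>)"
proof -
  obtain U V D where F: "cmp U" "cmp V" "cmp D" "\<And>p x. D p x > 0"
    "\<And>p x. F p x = (real (U p x) - real (V p x)) / real (D p x)"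
    using assms(1) by (rule rcmpE) (rule that)
  \<comment> \<open>At most one of the truncated differences \<open>u - v\<close> and
    \<open>v - u\<close> is nonzero, so their sum is the distance of \<open>u\<close> and
    \<open>v\<close>.\<close>
  have "\<bar>(real u - real v) / real d\<bar> = (real ((u - v) + (v - u)) - real 0) / real d" for u v d
    by (cases "u \<le> v") (auto simp: of_nat_diff abs_divide)
  with F show ?thesis
    by (intro rcmpI[where U = "\<lambda>p x. (U p x - V p x) + (V p x - U p x)"
          and V = "\<lambda>p x. 0" and D = D] cmp_add cmp_diff cmp_const) auto
qed

lemma rcmp_divide_nat:
  assumes "rcmp F" "cmp g" "\<And>p x. g p x > 0"
  shows "rcmp (\<lambda>p x. F p x / real (g p x))"
proof -
  have "rcmp (\<lambda>p x. 1 / real (g p x))"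
    by (rule rcmpI[where U = "\<lambda>p x. 1" and V = "\<lambda>p x. 0" and D = g])
      (use assms in \<open>simp_all add: cmp_const\<close>)
  from rcmp_mult[OF assms(1) this] show ?thesis by simp
qed

lemma dcmp_rless:
  assumes "rcmp F" "rcmp G"
  shows "dcmp (\<lambda>p x. F p x < G p x)"
proof -
  obtain U V D where F: "cmp U" "cmp V" "cmp D" "\<And>p x. D p x > 0"
    "\<And>p x. G p x - F p x = (real (U p x) - real (V p x)) / real (D p x)"
    using rcmp_diff[OF assms(2,1)] by (rule rcmpE) (rule that)
  have "dcmp (\<lambda>p x. V p x < U p x)" by (intro dcmp_less F)
  moreover have "V p x < U p x \<longleftrightarrow> F p x < G p x" for p x
  proof -
    have "F p x < G p x \<longleftrightarrow> 0 < (real (U p x) - real (V p x)) / real (D p x)"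
      using F(5)[of p x] by linarith
    also have "\<dots> \<longleftrightarrow> V p x < U p x" using F(4)[of p x] by (simp add: zero_less_divide_iff)
    finally show ?thesis by simp
  qed
  ultimately show ?thesis by simp
qed

lemma dcmp_rle:
  assumes "rcmp F" "rcmp G"
  shows "dcmp (\<lambda>p x. F p x \<le> G p x)"
  using dcmp_not[OF dcmp_rless[OF assms(2,1)]] by (simp add: not_less)

text \<open>The partial sums pass through a primitive recursion as triples of positive part,
  negative part and denominator; each step multiplies the denominators.\<close>

lemma rcmp_sum:
  assumes "rcmp (\<lambda>p z. F p (pfst z) (psnd z))" "cmp n"
  shows "rcmp (\<lambda>p x. \<Sum>i<n p x. F p x i)"
proof -
  obtain U V D where F: "cmp U" "cmp V" "cmp D" "\<And>p z. D p z > 0"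
    "\<And>p z. F p (pfst z) (psnd z) = (real (U p z) - real (V p z)) / real (D p z)"
    using assms(1) by (rule rcmpE) (rule that)
  have Fi: "F p x i = (real (U p (prod_encode (x, i))) - real (V p (prod_encode (x, i))))
      / real (D p (prod_encode (x, i)))" for p x i
    using F(5)[of p "prod_encode (x, i)"] by simp
  define st where "st = (\<lambda>p x i y. prod_encode
    (pfst y * D p (prod_encode (x, i)) + U p (prod_encode (x, i)) * psnd (psnd y),
     prod_encode (pfst (psnd y) * D p (prod_encode (x, i)) + V p (prod_encode (x, i)) * psnd (psnd y),
     psnd (psnd y) * D p (prod_encode (x, i)))))"
  define R where "R = (\<lambda>p x k. rec_nat (prod_encode (0, prod_encode (0, 1))) (st p x) k)"
  have R: "psnd (psnd (R p x k)) > 0 \<and>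
      (\<Sum>i<k. F p x i) = (real (pfst (R p x k)) - real (pfst (psnd (R p x k))))
        / real (psnd (psnd (R p x k)))" for p x k
  proof (induction k)
    case 0
    show ?case by (simp add: R_def)
  next
    case (Suc k)
    then show ?case using F(4)[of p "prod_encode (x, k)"]
      by (auto simp: R_def st_def Fi add_frac_eq less_imp_neq[symmetric] algebra_simps)
  qed
  have "cmp (\<lambda>p x. R p x (n p x))"
    unfolding R_def
  proof (rule cmp_rec)
    show "cmp (\<lambda>p z. st p (pfst z) (pfst (psnd z)) (psnd (psnd z)))"
      unfolding st_def
      by (intro cmp_pair cmp_add cmp_mult cmp_pfst cmp_psnd cmp_id
        cmp_compose[OF F(1)] cmp_compose[OF F(2)] cmp_compose[OF F(3)])
  qed (rule cmp_const assms(2))+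
  with R show ?thesis
    by (intro rcmpI[where U = "\<lambda>p x. pfst (R p x (n p x))"
          and V = "\<lambda>p x. pfst (psnd (R p x (n p x)))"
          and D = "\<lambda>p x. psnd (psnd (R p x (n p x)))"] cmp_pfst cmp_psnd) auto
qed

section \<open>Coded points and polynomials\<close>

text \<open>Codes of the nonnegative rationals, which are dense in the search interval; the
  successor keeps the denominator positive.\<close>

definition pt :: "nat \<Rightarrow> real" where
  "pt k = real (pfst k) / real (Suc (psnd k))"

lemma rcmp_pt_power:
  assumes "cmp f" "cmp n"
  shows "rcmp (\<lambda>p x. pt (f p x) ^ n p x)"
  unfolding pt_def power_divide of_nat_power[symmetric]
  by (intro rcmp_divide_nat rcmp_of_nat cmp_power cmp_pfst cmp_Suc cmp_psnd assms) simp

lemma rcmp_pt: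
  assumes "cmp f"
  shows "rcmp (\<lambda>p x. pt (f p x))"
  using rcmp_pt_power[OF assms cmp_const[of 1]] by simp

lemma rcmp_half_power:
  assumes "cmp n"
  shows "rcmp (\<lambda>p x. (1/2) ^ n p x)"
proof -
  have "rcmp (\<lambda>p x. real 1 / real (2 ^ n p x))"
    by (intro rcmp_divide_nat rcmp_of_nat cmp_power cmp_const assms) simp
  then show ?thesis by (simp add: power_divide)
qed

lemma rcmp_rat_of_code:
  assumes "cmp f"
  shows "rcmp (\<lambda>p x. rat_of_code (f p x))"
proof (rule rcmpI)
  show "cmp (\<lambda>p x. if pfst (f p x) mod 2 = 0 then pfst (f p x) div 2 else 0)"
    "cmp (\<lambda>p x. if pfst (f p x) mod 2 = 0 then 0 else Suc (pfst (f p x) div 2))"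
    "cmp (\<lambda>p x. Suc (psnd (f p x)))"
    by (intro cmp_if dcmp_eq cmp_mod2 cmp_div2 cmp_const cmp_Suc cmp_pfst cmp_psnd assms)+
  show "rat_of_code (f p x) =
      (real (if pfst (f p x) mod 2 = 0 then pfst (f p x) div 2 else 0)
       - real (if pfst (f p x) mod 2 = 0 then 0 else Suc (pfst (f p x) div 2)))
      / real (Suc (psnd (f p x)))" for p x
    by (cases "even (pfst (f p x))")
      (simp_all add: rat_of_code_def split_beta int_decode_def sum_decode_def odd_iff_mod_2_eq_one)
qed simp

text \<open>A nonempty list has the code \<open>Suc m\<close>, where \<open>m\<close> pairs its head
  with the code of its tail. The code 0 of the empty list is a fixed point of the tail map, so
  entries past the end are 0.\<close>

definition entry :: "nat \<Rightarrow> nat \<Rightarrow> nat" where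
  "entry c i = pfst (rec_nat c (\<lambda>_ y. psnd (y - Suc 0)) i - Suc 0)"

lemma cmp_entry:
  assumes "cmp f" "cmp g"
  shows "cmp (\<lambda>p x. entry (f p x) (g p x))"
  unfolding entry_def
  by (intro cmp_pfst cmp_pred cmp_rec[where g = "\<lambda>p x k y. psnd (y - Suc 0)"] assms
      cmp_psnd cmp_id)

lemma prod_decode_0 [simp]: "prod_decode 0 = (0, 0)"
proof -
  have "prod_encode (0, 0) = 0" by (simp add: prod_encode_def)
  then show ?thesis by (metis prod_encode_inverse)
qed

lemma list_decode_tails:
  "list_decode (rec_nat c (\<lambda>_ y. psnd (y - Suc 0)) i) = drop i (list_decode c)"
proof (induction i)
  case (Suc i)
  define r where "r = rec_nat c (\<lambda>_ y. psnd (y - Suc 0)) i"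
  have "list_decode (psnd (r - Suc 0)) = tl (list_decode r)"
    by (cases r) (auto simp: split_beta)
  with Suc show ?case by (simp add: r_def drop_Suc tl_drop)
qed simp

lemma entry_conv:
  "entry c i = (if i < length (list_decode c) then list_decode c ! i else 0)"
proof -
  define r where "r = rec_nat c (\<lambda>_ y. psnd (y - Suc 0)) i"
  have "drop i (list_decode c) = list_decode r" by (simp add: r_def list_decode_tails)
  then show ?thesis
    by (cases r) (auto simp: entry_def r_def[symmetric] split_beta
        nth_via_drop drop_eq_Nil2 not_less dest: arg_cong[of _ _ length])
qed

lemma length_list_decode_le: "length (list_decode c) \<le> c"
proof (induction c rule: less_induct)
  case (less c)
  show ?case
  proof (cases c)
    case (Suc m)
    have "psnd m \<le> m"
      using le_prod_encode_2[of "psnd m" "pfst m"] by simp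
    with less[of "psnd m"] Suc show ?thesis by (simp add: split_beta)
  qed simp
qed

text \<open>A list has at most as many entries as its code, and entries past the end contribute 0.
  So the code itself can serve as a computable upper limit of the sum.\<close>

lemma rat_poly_of_code_entry: "rat_poly_of_code c x = (\<Sum>i<c. rat_of_code (entry c i) * x ^ i)"
proof -
  have "(\<Sum>i<c. rat_of_code (entry c i) * x ^ i)
      = (\<Sum>i<length (list_decode c). rat_of_code (entry c i) * x ^ i)"
    using length_list_decode_le[of c]
    by (intro sum.mono_neutral_right)
      (auto simp: entry_conv rat_of_code_def
        int_decode_def sum_decode_def)
  also have "\<dots> = rat_poly_of_code c x"
    by (simp add: rat_poly_of_code_def entry_conv Let_def)
  finally show ?thesis by simp
qed

text \<open>A Lipschitz constant on \<open>[0,1]\<close>: the derivative of the monomial of degree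
  \<open>i\<close> is bounded there by \<open>i\<close> times the absolute value of its
  coefficient.\<close>

definition poly_lip :: "nat \<Rightarrow> real" where
  "poly_lip c = (\<Sum>i<c. \<bar>rat_of_code (entry c i)\<bar> * real i)"

lemma poly_lip_nonneg: "0 \<le> poly_lip c"
  unfolding poly_lip_def by (intro sum_nonneg) simp

lemma poly_lip_bound:
  assumes "x \<in> {0..1}" "y \<in> {0..1}"
  shows "\<bar>rat_poly_of_code c x - rat_poly_of_code c y\<bar> \<le> poly_lip c * \<bar>x - y\<bar>"
proof -
  have pow: "\<bar>x ^ i - y ^ i\<bar> \<le> real i * \<bar>x - y\<bar>" for i
    using norm_power_diff[of x y i] assms by auto
  have "\<bar>rat_poly_of_code c x - rat_poly_of_code c y\<bar>
      = \<bar>\<Sum>i<c. rat_of_code (entry c i) * (x ^ i - y ^ i)\<bar>"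
    by (simp add: rat_poly_of_code_entry sum_subtractf algebra_simps)
  also have "\<dots> \<le> (\<Sum>i<c. \<bar>rat_of_code (entry c i) * (x ^ i - y ^ i)\<bar>)"
    by (rule sum_abs)
  also have "\<dots> \<le> (\<Sum>i<c. \<bar>rat_of_code (entry c i)\<bar> * (real i * \<bar>x - y\<bar>))"
    by (intro sum_mono) (simp add: abs_mult mult_left_mono pow)
  also have "\<dots> = poly_lip c * \<bar>x - y\<bar>"
    by (simp add: poly_lip_def sum_distrib_right mult.assoc)
  finally show ?thesis .
qed

lemma rcmp_poly:
  assumes "cmp f" "cmp g"
  shows "rcmp (\<lambda>p x. rat_poly_of_code (f p x) (pt (g p x)))"
  unfolding rat_poly_of_code_entry
  by (intro rcmp_sum[where F = "\<lambda>p x i. rat_of_code (entry (f p x) i) * pt (g p x) ^ i"]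
      rcmp_mult rcmp_rat_of_code rcmp_pt_power cmp_entry assms cmp_psnd cmp_id
      cmp_compose[OF assms(1)] cmp_compose[OF assms(2)] cmp_pfst)

lemma rcmp_poly_lip:
  assumes "cmp f"
  shows "rcmp (\<lambda>p x. poly_lip (f p x))"
  unfolding poly_lip_def
  by (intro rcmp_sum[where F = "\<lambda>p x i. \<bar>rat_of_code (entry (f p x) i)\<bar> * real i"]
      rcmp_mult rcmp_abs rcmp_rat_of_code rcmp_of_nat cmp_entry assms cmp_psnd cmp_id
      cmp_compose[OF assms(1)] cmp_pfst)

section \<open>Local minima of the absolute value\<close>

text \<open>A minimum over \<open>[u, v]\<close> exists. If it is attained at an endpoint, then
  \<open>q\<close> is no higher and is itself a minimum in the interior.\<close>

lemma interior_local_min: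
  fixes h :: "real \<Rightarrow> real"
  assumes "continuous_on {0..1} h" "0 \<le> u" "u < q" "q < v" "v \<le> 1" "h q \<le> h u" "h q \<le> h v"
  shows "\<exists>x. u < x \<and> x < v \<and> local_min_01 h x"
proof -
  have "continuous_on {u..v} h"
    using assms by (auto intro: continuous_on_subset)
  then obtain m where m: "m \<in> {u..v}" "\<forall>y\<in>{u..v}. h m \<le> h y"
    using continuous_attains_inf[of "{u..v}" h] assms by auto
  define x where "x = (if m = u \<or> m = v then q else m)"
  have x: "u < x" "x < v" using m assms by (auto simp: x_def)
  have min: "h x \<le> h y" if "y \<in> {u..v}" for y
    using m that assms by (auto simp: x_def intro: order_trans)
  have "h x \<le> h y" if "\<bar>y - x\<bar> < min (x - u) (v - x)" for y
    using that by (intro min) auto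
  then have "local_min_01 h x"
    unfolding local_min_01_def
    using x assms(2,5) by (intro conjI exI[of _ "min (x - u) (v - x)"]) auto
  with x show ?thesis by blast
qed

text \<open>By continuity \<open>f\<close> stays positive near \<open>y\<close>, and there
  \<open>|f|\<close> is \<open>f\<close>.\<close>

lemma local_min_abs_pos:
  assumes "continuous_on {0..1} f" "local_min_01 (\<lambda>x. \<bar>f x\<bar>) y" "f y > 0"
  shows "local_min_01 f y"
proof -
  obtain e where e: "e > 0" "\<And>t. t \<in> {0..1} \<Longrightarrow> \<bar>t - y\<bar> < e \<Longrightarrow> \<bar>f y\<bar> \<le> \<bar>f t\<bar>" and y: "y \<in> {0..1}"
    using assms(2) unfolding local_min_01_def by blast
  obtain d where d: "d > 0" "\<And>t. t \<in> {0..1} \<Longrightarrow> \<bar>t - y\<bar> < d \<Longrightarrow> \<bar>f t - f y\<bar> < f y"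
    using assms(1) y \<open>f y > 0\<close> unfolding continuous_on_iff dist_real_def by blast
  have "f y \<le> f t" if "t \<in> {0..1}" "\<bar>t - y\<bar> < min e d" for t
    using e(2)[of t] d(2)[of t] that by auto
  with e d y show ?thesis
    unfolding local_min_01_def by (intro conjI exI[of _ "min e d"]) auto
qed

lemma local_min_abs_neg:
  assumes "continuous_on {0..1} f" "local_min_01 (\<lambda>x. \<bar>f x\<bar>) y" "f y < 0"
  obtains e where "e > 0" "\<And>t. t \<in> {0..1} \<Longrightarrow> \<bar>t - y\<bar> < e \<Longrightarrow> f t \<le> f y"
proof -
  have "continuous_on {0..1} (\<lambda>x. - f x)" using assms(1) by (rule continuous_on_minus)
  from local_min_abs_pos[OF this, of y] assms(2,3) have "local_min_01 (\<lambda>x. - f x) y" by simp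
  then show thesis using that unfolding local_min_01_def by auto
qed

text \<open>Without a local minimum of \<open>f\<close> in \<open>(x, z)\<close>, the function is strictly quasiconcave there and
  \<open>f y \<le> 0\<close>. Then \<open>f\<close> is smaller at \<open>x\<close>, say, so \<open>x\<close> is a local maximum of \<open>f\<close>, although \<open>f\<close>
  exceeds \<open>f x\<close> on \<open>(x, y)\<close>.\<close>
lemma local_min_between:
  assumes f: "continuous_on {0..1} f" and "x < y" "y < z"
    and mx: "local_min_01 (\<lambda>x. \<bar>f x\<bar>) x" and my: "local_min_01 (\<lambda>x. \<bar>f x\<bar>) y"
    and mz: "local_min_01 (\<lambda>x. \<bar>f x\<bar>) z"
  shows "\<exists>s. x < s \<and> s < z \<and> local_min_01 f s"
proof (rule ccontr)
  assume no: "\<nexists>s. x < s \<and> s < z \<and> local_min_01 f s"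
  have xz: "0 \<le> x" "z \<le> 1" using mx mz by (auto simp: local_min_01_def)
  \<comment> \<open>Otherwise \<open>q\<close> is no higher than either end, which forces a local
    minimum of \<open>f\<close> in between.\<close>
  have conc: "f u < f q \<or> f v < f q" if "x \<le> u" "u < q" "q < v" "v \<le> z" for u q v
  proof (rule ccontr)
    assume "\<not> (f u < f q \<or> f v < f q)"
    then have "\<exists>s. u < s \<and> s < v \<and> local_min_01 f s"
      using that xz by (intro interior_local_min[OF f, of u q v]) auto
    with no that show False by force
  qed
  have "f y \<le> 0"
    using local_min_abs_pos[OF f my] no assms(2,3) by force
  from conc[of x y z] assms(2,3) consider "f x < f y" | "f z < f y" by auto
  then show False
  proof cases
    case 1
    with \<open>f y \<le> 0\<close> obtain e where e: "e > 0"
      "\<And>t. t \<in> {0..1} \<Longrightarrow> \<bar>t - x\<bar> < e \<Longrightarrow> f t \<le> f x"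
      using local_min_abs_neg[OF f mx] by auto
    \<comment> \<open>A point of \<open>(x, y)\<close> so close to \<open>x\<close> that
      \<open>f t \<le> f x\<close>. As \<open>f x < f y\<close>, this contradicts both alternatives
      of \<open>conc\<close> for \<open>x\<close>, \<open>t\<close>, \<open>y\<close>. The second
      case is its mirror image.\<close>
    define t where "t = x + min (e / 2) ((y - x) / 2)"
    have t: "x < t" "t < y" "\<bar>t - x\<bar> < e" using e(1) assms(2) by (auto simp: t_def min_def field_simps)
    with e(2)[of t] conc[of x t y] 1 xz assms(2,3) show False by auto
  next
    case 2
    with \<open>f y \<le> 0\<close> obtain e where e: "e > 0"
      "\<And>t. t \<in> {0..1} \<Longrightarrow> \<bar>t - z\<bar> < e \<Longrightarrow> f t \<le> f z"
      using local_min_abs_neg[OF f mz] by auto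
    define t where "t = z - min (e / 2) ((z - y) / 2)"
    have t: "t < z" "y < t" "\<bar>t - z\<bar> < e" using e(1) assms(3) by (auto simp: t_def min_def field_simps)
    with e(2)[of t] conc[of y t z] 2 xz assms(2,3) show False by auto
  qed
qed

lemma card_ge_3_obtain:
  fixes A :: "'a :: linorder set"
  assumes "finite A" "card A > 2"
  obtains x y z where "x \<in> A" "y \<in> A" "z \<in> A" "x < y" "y < z"
proof -
  have "A \<noteq> {}" using assms by auto
  have "card {Min A, Max A} < card A"
    using assms by (intro le_less_trans[OF card_insert_le_m1[of 2]]) auto
  then have "\<not> A \<subseteq> {Min A, Max A}" using card_mono[of "{Min A, Max A}" A] by auto
  then obtain y where y: "y \<in> A" "y \<noteq> Min A" "y \<noteq> Max A" by auto
  with assms(1) \<open>A \<noteq> {}\<close> have "Min A < y" "y < Max A"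
    by (auto simp: less_le intro: Min_le Max_ge)
  with y assms(1) \<open>A \<noteq> {}\<close> that show thesis by (meson Min_in Max_in)
qed

definition abs_minima :: "(real \<Rightarrow> real) \<Rightarrow> real \<Rightarrow> real \<Rightarrow> real set" where
  "abs_minima f u v = {x. u < x \<and> x < v \<and> local_min_01 (\<lambda>x. \<bar>f x\<bar>) x}"

text \<open>Let \<open>h x\<close> count the local minima of \<open>f\<close> up to
  \<open>x\<close>. Three local minima of \<open>|f|\<close> with equal count are impossible, since
  a local minimum of \<open>f\<close> lies between the outer two. So each of the
  \<open>card ?S + 1\<close> possible counts occurs at most twice. Finite subsets \<open>T\<close>
  are counted first because finiteness is part of the claim.\<close>

lemma abs_minima_bound:
  assumes f: "continuous_on {0..1} f" and S: "finite {x. local_min_01 f x}"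
  shows "finite (abs_minima f u v) \<and> card (abs_minima f u v) \<le> 2 * (card {x. local_min_01 f x} + 1)"
proof (rule finite_if_finite_subsets_card_bdd)
  fix T assume T: "T \<subseteq> abs_minima f u v" "finite T"
  let ?S = "{x. local_min_01 f x}"
  define h where "h x = card {s \<in> ?S. s \<le> x}" for x
  have "h x \<le> card ?S" for x
    unfolding h_def by (rule card_mono[OF S]) auto
  then have "T = (\<Union>k\<le>card ?S. {x \<in> T. h x = k})" by auto
  then have "card T \<le> (\<Sum>k\<le>card ?S. card {x \<in> T. h x = k})"
    using card_UN_le[of "{..card ?S}" "\<lambda>k. {x \<in> T. h x = k}"] by simp
  also have "\<dots> \<le> (\<Sum>k\<le>card ?S. 2)"
  proof (rule sum_mono, rule ccontr)
    fix k assume "\<not> card {x \<in> T. h x = k} \<le> 2"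
    then have "2 < card {x \<in> T. h x = k}" by simp
    then obtain x y z where xyz: "x \<in> {x \<in> T. h x = k}" "y \<in> {x \<in> T. h x = k}"
      "z \<in> {x \<in> T. h x = k}" "x < y" "y < z"
      using T(2) by (elim card_ge_3_obtain[rotated]) auto
    then obtain s where s: "x < s" "s < z" "s \<in> ?S"
      using local_min_between[OF f, of x y z] T(1) by (auto simp: abs_minima_def)
    have "{s \<in> ?S. s \<le> x} \<subset> {s \<in> ?S. s \<le> z}"
    proof
      show "{s \<in> ?S. s \<le> x} \<subseteq> {s \<in> ?S. s \<le> z}" using xyz by auto
      have "s \<in> {s \<in> ?S. s \<le> z}" "s \<notin> {s \<in> ?S. s \<le> x}" using s by auto
      then show "{s \<in> ?S. s \<le> x} \<noteq> {s \<in> ?S. s \<le> z}" by blast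
    qed
    then have "h x < h z"
      unfolding h_def using S by (intro psubset_card_mono) auto
    with xyz show False by auto
  qed
  finally show "card T \<le> 2 * (card ?S + 1)" by simp
qed

section \<open>The interval search\<close>

definition tup :: "nat \<Rightarrow> nat \<Rightarrow> nat \<Rightarrow> nat \<Rightarrow> nat \<Rightarrow> nat" where
  "tup a b c d e = prod_encode (a, prod_encode (b, prod_encode (c, prod_encode (d, e))))"
definition c0 :: "nat \<Rightarrow> nat" where "c0 x = pfst x"
definition c1 :: "nat \<Rightarrow> nat" where "c1 x = pfst (psnd x)"
definition c2 :: "nat \<Rightarrow> nat" where "c2 x = pfst (psnd (psnd x))"
definition c3 :: "nat \<Rightarrow> nat" where "c3 x = pfst (psnd (psnd (psnd x)))"
definition c4 :: "nat \<Rightarrow> nat" where "c4 x = psnd (psnd (psnd (psnd x)))"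

lemma tup_simps [simp]:
  "c0 (tup a b c d e) = a" "c1 (tup a b c d e) = b" "c2 (tup a b c d e) = c"
  "c3 (tup a b c d e) = d" "c4 (tup a b c d e) = e"
  by (simp_all add: tup_def c0_def c1_def c2_def c3_def c4_def)

lemma cmp_tup:
  "cmp f \<Longrightarrow> cmp (\<lambda>p x. c0 (f p x))" "cmp f \<Longrightarrow> cmp (\<lambda>p x. c1 (f p x))"
  "cmp f \<Longrightarrow> cmp (\<lambda>p x. c2 (f p x))" "cmp f \<Longrightarrow> cmp (\<lambda>p x. c3 (f p x))"
  "cmp f \<Longrightarrow> cmp (\<lambda>p x. c4 (f p x))"
  "cmp f0 \<Longrightarrow> cmp f1 \<Longrightarrow> cmp f2 \<Longrightarrow> cmp f3 \<Longrightarrow> cmp f4 \<Longrightarrow>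
    cmp (\<lambda>p x. tup (f0 p x) (f1 p x) (f2 p x) (f3 p x) (f4 p x))"
  unfolding tup_def c0_def c1_def c2_def c3_def c4_def by (intro cmp_arith; assumption)+

definition val :: "(nat \<Rightarrow> nat) \<Rightarrow> nat \<Rightarrow> nat \<Rightarrow> real" where
  "val p t k = rat_poly_of_code (p t) (pt k)"

text \<open>A decidable certificate that \<open>f\<close> has no zero between \<open>pt k\<close>
  and \<open>pt l\<close>: the value at \<open>pt k\<close> exceeds the approximation error plus the
  largest possible change of the polynomial on the way to \<open>pt l\<close>.\<close>

definition clear :: "(nat \<Rightarrow> nat) \<Rightarrow> nat \<Rightarrow> nat \<Rightarrow> nat \<Rightarrow> bool" where
  "clear p t k l \<longleftrightarrow> (1/2) ^ t + poly_lip (p t) * \<bar>pt l - pt k\<bar> < \<bar>val p t k\<bar>"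

text \<open>A decidable certificate for \<open>|f|\<close> being smaller at \<open>pt k\<close> than
  at \<open>pt l\<close>; the factor 2 covers the errors at both points.\<close>

definition smaller :: "(nat \<Rightarrow> nat) \<Rightarrow> nat \<Rightarrow> nat \<Rightarrow> nat \<Rightarrow> bool" where
  "smaller p t k l \<longleftrightarrow> \<bar>val p t k\<bar> + real 2 * (1/2) ^ t < \<bar>val p t l\<bar>"

text \<open>Certifies valleys of \<open>|f|\<close> on both sides of \<open>c\<close>, with low
  points \<open>q\<close> and \<open>q'\<close>. Heights are compared at \<open>A\<close> and
  \<open>B\<close> rather than at \<open>a\<close> and \<open>b\<close>: \<open>A\<close> and
  \<open>B\<close> change only at splits, so the comparisons survive while \<open>a\<close> and
  \<open>b\<close> approach zeros.\<close>

definition splits :: "(nat \<Rightarrow> nat) \<Rightarrow> nat \<Rightarrow> nat \<Rightarrow> nat \<Rightarrow> nat \<Rightarrow> nat \<Rightarrow> bool" where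
  "splits p e A B a b \<longleftrightarrow> c0 e = 0 \<and>
     pt A < pt (c3 e) \<and> pt (c3 e) < pt (c2 e) \<and> pt (c2 e) < pt (c4 e) \<and> pt (c4 e) < pt B \<and>
     pt a < pt (c2 e) \<and> pt (c2 e) < pt b \<and>
     smaller p (c1 e) (c3 e) A \<and> smaller p (c1 e) (c3 e) (c2 e) \<and>
     smaller p (c1 e) (c4 e) (c2 e) \<and> smaller p (c1 e) (c4 e) B"

definition moves :: "(nat \<Rightarrow> nat) \<Rightarrow> nat \<Rightarrow> nat \<Rightarrow> nat \<Rightarrow> nat \<Rightarrow> bool" where
  "moves p e a b k \<longleftrightarrow> pt a \<le> pt (c2 e) \<and> pt (c2 e) \<le> pt b \<and> clear p (c1 e) k (c2 e)"

text \<open>A state \<open>tup A B a b w\<close> consists of codes of points \<open>A \<le> a \<le> b \<le> B\<close> such that all zeros in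
  \<open>[A, B]\<close> lie in \<open>[a, b]\<close>, and of a word \<open>w\<close> whose binary digits decide which half to keep.
  The command \<open>e = tup kind t c q q'\<close> asks for an action based on precision \<open>t\<close>, which is only
  carried out if it is justified.\<close>
definition step :: "(nat \<Rightarrow> nat) \<Rightarrow> nat \<Rightarrow> nat \<Rightarrow> nat" where
  "step p e x =
    (if splits p e (c0 x) (c1 x) (c2 x) (c3 x) then
       (if c4 x mod 2 = 0 then tup (c0 x) (c2 e) (c2 x) (c2 e) (c4 x div 2)
        else tup (c2 e) (c1 x) (c2 e) (c3 x) (c4 x div 2))
     else if c0 e = 1 \<and> moves p e (c2 x) (c3 x) (c2 x) then tup (c0 x) (c1 x) (c2 e) (c3 x) (c4 x)
     else if c0 e = 2 \<and> moves p e (c2 x) (c3 x) (c3 x) then tup (c0 x) (c1 x) (c2 x) (c2 e) (c4 x)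
     else x)"

definition start :: "nat \<Rightarrow> nat" where
  "start w = tup 0 (prod_encode (1, 0)) 0 (prod_encode (1, 0)) w"

text \<open>Every command \<open>e\<close> is the first component of infinitely many stages.\<close>
definition run :: "(nat \<Rightarrow> nat) \<Rightarrow> nat \<Rightarrow> nat \<Rightarrow> nat" where
  "run p w s = rec_nat (start w) (\<lambda>s. step p (pfst s)) s"

lemma run_simps [simp]: "run p w 0 = start w" "run p w (Suc s) = step p (pfst s) (run p w s)"
  by (simp_all add: run_def)

lemma pt_0 [simp]: "pt 0 = 0" and pt_1 [simp]: "pt (prod_encode (Suc 0, 0)) = 1"
  by (simp_all add: pt_def)

lemma rcmp_val: "cmp t \<Longrightarrow> cmp k \<Longrightarrow> rcmp (\<lambda>p x. val p (t p x) (k p x))"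
  unfolding val_def by (intro rcmp_poly cmp_oracle)

lemma dcmp_clear:
  "cmp t \<Longrightarrow> cmp k \<Longrightarrow> cmp l \<Longrightarrow> dcmp (\<lambda>p x. clear p (t p x) (k p x) (l p x))"
  unfolding clear_def
  by (intro dcmp_rless rcmp_add rcmp_half_power rcmp_mult rcmp_poly_lip rcmp_abs rcmp_diff
      rcmp_pt rcmp_val cmp_oracle)

lemma dcmp_smaller:
  "cmp t \<Longrightarrow> cmp k \<Longrightarrow> cmp l \<Longrightarrow> dcmp (\<lambda>p x. smaller p (t p x) (k p x) (l p x))"
  unfolding smaller_def
  by (intro dcmp_rless rcmp_add rcmp_half_power rcmp_mult rcmp_abs rcmp_of_nat cmp_const
      rcmp_pt rcmp_val cmp_oracle)

lemma cmp_step: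
  assumes "cmp e" "cmp x"
  shows "cmp (\<lambda>p y. step p (e p y) (x p y))"
  unfolding step_def splits_def moves_def
  by (intro cmp_if dcmp_conj dcmp_rless dcmp_rle dcmp_eq rcmp_pt dcmp_smaller dcmp_clear cmp_tup
      cmp_mod2 cmp_div2 cmp_const assms)

lemma cmp_run:
  assumes "cmp w" "cmp s"
  shows "cmp (\<lambda>p x. run p (w p x) (s p x))"
  unfolding run_def start_def
  by (intro cmp_rec[where g = "\<lambda>p x s. step p (pfst s)"] cmp_step cmp_tup cmp_arith assms)

text \<open>Unbounded search need not terminate for every oracle. The program is therefore chosen
  first, and its behaviour is asserted only for oracles on which every search succeeds.\<close>

lemma cmp_minimization:
  assumes "cmp test" "cmp out"
  shows "\<exists>e. \<forall>p. (\<forall>x. \<exists>s. test p (prod_encode (x, s)) = 0) \<longrightarrow>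
    (\<forall>x. rf_eval p e x (out p (prod_encode (x, LEAST s. test p (prod_encode (x, s)) = 0))))"
proof -
  obtain et where et: "\<And>p x. rf_eval p et x (test p x)"
    using assms(1) unfolding cmp_def by blast
  obtain eo where eo: "\<And>p x. rf_eval p eo x (out p x)"
    using assms(2) unfolding cmp_def by blast
  have "rf_eval p (RComp eo (RPair RId (RMu et))) x
      (out p (prod_encode (x, LEAST s. test p (prod_encode (x, s)) = 0)))"
    if "\<And>x. \<exists>s. test p (prod_encode (x, s)) = 0" for p x
  proof -
    let ?s = "LEAST s. test p (prod_encode (x, s)) = 0"
    have "test p (prod_encode (x, ?s)) = 0" using that[of x] by (rule LeastI_ex)
    moreover have "test p (prod_encode (x, m)) \<noteq> 0" if "m < ?s" for m
      using not_less_Least[OF that] .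
    ultimately have "rf_eval p (RMu et) x ?s"
      using et by (intro rf_eval.intros(11)) metis+
    then show ?thesis
      by (intro rf_eval.intros(7)[OF rf_eval.intros(8)[OF rf_eval.intros(3)] eo])
  qed
  then show ?thesis by blast
qed

section \<open>Correctness of the search\<close>

lemma pt_nonneg [simp]: "0 \<le> pt k"
  by (simp add: pt_def)

lemma pt_dense:
  assumes "0 \<le> u" "u < v"
  obtains k where "u < pt k" "pt k < v"
proof -
  obtain r where r: "r \<in> \<rat>" "u < r" "r < v" using Rats_dense_in_real[OF assms(2)] by blast
  obtain m n :: nat where mn: "n \<noteq> 0" "\<bar>r\<bar> = real m / real n"
    using Rats_abs_nat_div_natE[OF r(1)] by metis
  have "pt (prod_encode (m, n - 1)) = r"
    using mn assms r by (simp add: pt_def)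
  with r that show thesis by metis
qed

lemma tendsto_bounded_mono:
  fixes u :: "nat \<Rightarrow> real"
  assumes "\<And>s. u s \<le> u (Suc s)" "\<And>s. u s \<le> C"
  obtains l where "u \<longlonglongrightarrow> l" "\<And>s. u s \<le> l"
  using incseq_convergent[of u C] assms by (auto simp: incseq_Suc_iff)

section \<open>Soundness of the tests and the search invariant\<close>

locale zero_search =
  fixes p :: "nat \<Rightarrow> nat" and f :: "real \<Rightarrow> real" and n :: nat
  assumes name: "cfun_rep p f" and dom: "f \<in> zero_nmin_dom n"
begin

lemma cont: "continuous_on {0..1} f"
  using name by (simp add: cfun_rep_def)

lemma cont_abs: "continuous_on {0..1} (\<lambda>x. \<bar>f x\<bar>)"
  using cont by (rule continuous_on_rabs)

lemma approx: "x \<in> {0..1} \<Longrightarrow> \<bar>f x - rat_poly_of_code (p t) x\<bar> \<le> (1/2) ^ t"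
  using name by (simp add: cfun_rep_def)

lemma finite_minima: "finite (abs_minima f u v)"
  and card_minima: "card (abs_minima f u v) \<le> 2 * (n + 1)"
  using abs_minima_bound[OF cont, of u v] dom by (auto simp: zero_nmin_dom_def)

text \<open>The polynomial changes by at most the Lipschitz bound between \<open>pt k\<close> and
  \<open>x\<close>, and \<open>f x\<close> differs from it by at most \<open>(1/2) ^ t\<close>. The
  two together cannot cancel the value at \<open>pt k\<close>.\<close>

lemma clear_imp_nonzero:
  assumes "clear p t k l" "pt k \<le> 1" "pt l \<le> 1"
    and x: "x \<in> closed_segment (pt k) (pt l)"
  shows "f x \<noteq> 0"
proof -
  have x01: "x \<in> {0..1}"
    using x assms(2,3) by (auto simp: closed_segment_eq_real_ivl split: if_splits intro: order_trans[OF pt_nonneg])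
  have "\<bar>x - pt k\<bar> \<le> \<bar>pt l - pt k\<bar>"
    using x by (auto simp: closed_segment_eq_real_ivl split: if_splits)
  then have "poly_lip (p t) * \<bar>x - pt k\<bar> \<le> poly_lip (p t) * \<bar>pt l - pt k\<bar>"
    by (intro mult_left_mono poly_lip_nonneg)
  moreover have "\<bar>rat_poly_of_code (p t) x - val p t k\<bar> \<le> poly_lip (p t) * \<bar>x - pt k\<bar>"
    unfolding val_def using x01 assms(2) by (intro poly_lip_bound) auto
  ultimately show ?thesis
    using assms(1) approx[OF x01, of t] unfolding clear_def by auto
qed

lemma smaller_imp_less:
  assumes "smaller p t k l" "pt k \<le> 1" "pt l \<le> 1"
  shows "\<bar>f (pt k)\<bar> < \<bar>f (pt l)\<bar>"
  using assms approx[of "pt k" t] approx[of "pt l" t] unfolding smaller_def val_def by auto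

text \<open>The margin 4 consists of 2 for the approximation errors at the two points and 2 for the
  gap that the test demands.\<close>

lemma less_imp_smaller:
  assumes "\<bar>f (pt k)\<bar> + 4 * (1/2) ^ t < \<bar>f (pt l)\<bar>" "pt k \<le> 1" "pt l \<le> 1"
  shows "smaller p t k l"
  using assms approx[of "pt k" t] approx[of "pt l" t] unfolding smaller_def val_def by auto

text \<open>The excluded ranges are closed, so \<open>f\<close> is nonzero at all four points even
  where a range degenerates to a point.\<close>

definition inv :: "nat \<Rightarrow> nat \<Rightarrow> nat \<Rightarrow> nat \<Rightarrow> bool" where
  "inv A B a b \<longleftrightarrow> pt A \<le> pt a \<and> pt a \<le> pt b \<and> pt b \<le> pt B \<and> pt B \<le> 1 \<and>
     (\<forall>x. pt A \<le> x \<and> x \<le> pt a \<or> pt b \<le> x \<and> x \<le> pt B \<longrightarrow> f x \<noteq> 0)"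

lemma splits_nonzero:
  assumes "inv A B a b" "splits p e A B a b"
  shows "f (pt (c2 e)) \<noteq> 0"
proof -
  have "smaller p (c1 e) (c3 e) (c2 e)" "pt (c3 e) \<le> 1" "pt (c2 e) \<le> 1"
    using assms by (auto simp: splits_def inv_def)
  from smaller_imp_less[OF this] show ?thesis by auto
qed

lemma splits_inv:
  assumes "inv A B a b" "splits p e A B a b"
  shows "inv A (c2 e) a (c2 e)" "inv (c2 e) B (c2 e) b"
  using assms splits_nonzero[OF assms] by (auto simp: inv_def splits_def dest: antisym)

text \<open>A split leaves a local minimum of \<open>|f|\<close> on either side, hence each side has fewer of them.\<close>
lemma splits_card:
  assumes "inv A B a b" "splits p e A B a b"
  shows "card (abs_minima f (pt A) (pt (c2 e))) < card (abs_minima f (pt A) (pt B))"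
    and "card (abs_minima f (pt (c2 e)) (pt B)) < card (abs_minima f (pt A) (pt B))"
proof -
  have ord: "pt A < pt (c3 e)" "pt (c3 e) < pt (c2 e)" "pt (c2 e) < pt (c4 e)" "pt (c4 e) < pt B"
    "pt B \<le> 1"
    using assms by (auto simp: splits_def inv_def)
  have sm: "\<bar>f (pt (c3 e))\<bar> < \<bar>f (pt A)\<bar>" "\<bar>f (pt (c3 e))\<bar> < \<bar>f (pt (c2 e))\<bar>"
    "\<bar>f (pt (c4 e))\<bar> < \<bar>f (pt (c2 e))\<bar>" "\<bar>f (pt (c4 e))\<bar> < \<bar>f (pt B)\<bar>"
    using assms(2) ord by (auto simp: splits_def intro!: smaller_imp_less)
  obtain x where x: "x \<in> abs_minima f (pt A) (pt (c2 e))"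
    using interior_local_min[OF cont_abs, of "pt A" "pt (c3 e)" "pt (c2 e)"] ord sm
    by (auto simp: abs_minima_def)
  obtain y where y: "y \<in> abs_minima f (pt (c2 e)) (pt B)"
    using interior_local_min[OF cont_abs, of "pt (c2 e)" "pt (c4 e)" "pt B"] ord sm
    by (auto simp: abs_minima_def)
  have sub: "abs_minima f (pt A) (pt (c2 e)) \<union> abs_minima f (pt (c2 e)) (pt B)
      \<subseteq> abs_minima f (pt A) (pt B)"
    using ord by (auto simp: abs_minima_def)
  have disj: "abs_minima f (pt A) (pt (c2 e)) \<inter> abs_minima f (pt (c2 e)) (pt B) = {}"
    by (auto simp: abs_minima_def)
  show "card (abs_minima f (pt A) (pt (c2 e))) < card (abs_minima f (pt A) (pt B))"
    using sub disj y by (intro psubset_card_mono finite_minima) blast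
  show "card (abs_minima f (pt (c2 e)) (pt B)) < card (abs_minima f (pt A) (pt B))"
    using sub disj x by (intro psubset_card_mono finite_minima) blast
qed

lemma moves_left_inv:
  assumes "inv A B a b" "moves p e a b a"
  shows "inv A B (c2 e) b"
proof -
  have "pt (c2 e) \<le> 1" "pt a \<le> 1" using assms by (auto simp: inv_def moves_def)
  then have "f x \<noteq> 0" if "pt a \<le> x" "x \<le> pt (c2 e)" for x
    using clear_imp_nonzero[of "c1 e" a "c2 e" x] assms(2) that
    by (auto simp: moves_def closed_segment_eq_real_ivl)
  with assms show ?thesis unfolding inv_def moves_def by (meson linear order_trans)
qed

lemma moves_right_inv:
  assumes "inv A B a b" "moves p e a b b"
  shows "inv A B a (c2 e)"
proof -
  have "pt (c2 e) \<le> 1" "pt b \<le> 1" using assms by (auto simp: inv_def moves_def)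
  then have "f x \<noteq> 0" if "pt (c2 e) \<le> x" "x \<le> pt b" for x
    using clear_imp_nonzero[of "c1 e" b "c2 e" x] assms(2) that
    by (auto simp: moves_def closed_segment_eq_real_ivl)
  with assms show ?thesis unfolding inv_def moves_def by (meson linear order_trans)
qed

definition good :: "nat \<Rightarrow> bool" where
  "good x \<longleftrightarrow> inv (c0 x) (c1 x) (c2 x) (c3 x)"

text \<open>The number of local minima of \<open>|f|\<close> strictly between \<open>A\<close> and
  \<open>B\<close> acts as a potential: it never increases and drops at each split.\<close>

lemma good_step:
  assumes "good x"
  shows "good (step p e x)" and "pt (c2 x) \<le> pt (c2 (step p e x))"
    and "pt (c3 (step p e x)) \<le> pt (c3 x)"
    and "card (abs_minima f (pt (c0 (step p e x))) (pt (c1 (step p e x))))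
      \<le> card (abs_minima f (pt (c0 x)) (pt (c1 x)))"
    and "splits p e (c0 x) (c1 x) (c2 x) (c3 x) \<Longrightarrow>
      card (abs_minima f (pt (c0 (step p e x))) (pt (c1 (step p e x))))
      < card (abs_minima f (pt (c0 x)) (pt (c1 x)))"
  using assms splits_inv[of "c0 x" "c1 x" "c2 x" "c3 x" e] splits_card[of "c0 x" "c1 x" "c2 x" "c3 x" e]
    moves_left_inv[of "c0 x" "c1 x" "c2 x" "c3 x" e] moves_right_inv[of "c0 x" "c1 x" "c2 x" "c3 x" e]
  by (auto simp: good_def step_def splits_def moves_def)

lemma good_run: "good (run p w s)"
proof (induction s)
  case 0
  have "f 0 \<noteq> 0" "f 1 \<noteq> 0" using dom by (auto simp: zero_nmin_dom_def)
  then show ?case by (auto simp: good_def start_def inv_def dest: antisym)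
qed (simp add: good_step)

lemma run_in_unit: "pt (c2 (run p w s)) \<le> pt (c3 (run p w s))" "pt (c3 (run p w s)) \<le> 1"
  using good_run[of w s] by (auto simp: good_def inv_def)

lemma run_left_mono: "s \<le> s' \<Longrightarrow> pt (c2 (run p w s)) \<le> pt (c2 (run p w s'))"
  by (rule lift_Suc_mono_le[where f = "\<lambda>s. pt (c2 (run p w s))"]) (simp_all add: good_step good_run)

lemma run_right_antimono: "s \<le> s' \<Longrightarrow> pt (c3 (run p w s')) \<le> pt (c3 (run p w s))"
  by (rule lift_Suc_antimono_le[where f = "\<lambda>s. pt (c3 (run p w s))"]) (simp_all add: good_step good_run)

section \<open>Existence of justified commands\<close>

lemma near_pt:
  assumes "0 \<le> u" "u < v" "v \<le> 1" "x \<in> {u..v}" "e > 0"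
  obtains q where "u < pt q" "pt q < v" "\<bar>f (pt q) - f x\<bar> < e"
proof -
  obtain d where d: "d > 0" "\<And>t. t \<in> {0..1} \<Longrightarrow> \<bar>t - x\<bar> < d \<Longrightarrow> \<bar>f t - f x\<bar> < e"
    using cont assms unfolding continuous_on_iff dist_real_def
    by (metis atLeastAtMost_iff order_trans)
  \<comment> \<open>Even if \<open>x\<close> is an endpoint, \<open>(u, v)\<close> and
    \<open>(x - d, x + d)\<close> overlap in an open interval, which contains a coded point.\<close>
  have "max u (x - d) < min v (x + d)" "0 \<le> max u (x - d)" using assms d(1) by auto
  then obtain q where "max u (x - d) < pt q" "pt q < min v (x + d)" using pt_dense by metis
  with assms d(2)[of "pt q"] show thesis by (intro that[of q]) auto
qed

text \<open>If \<open>f\<close> vanished throughout \<open>(u, v)\<close>, each of these infinitely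
  many points would be a minimum of \<open>|f|\<close>.\<close>

lemma nonzero_pt:
  assumes "0 \<le> u" "u < v" "v \<le> 1"
  obtains c where "u < pt c" "pt c < v" "f (pt c) \<noteq> 0"
proof -
  have "\<exists>x\<in>{u<..<v}. f x \<noteq> 0"
  proof (rule ccontr)
    assume "\<not> (\<exists>x\<in>{u<..<v}. f x \<noteq> 0)"
    then have "{u<..<v} \<subseteq> abs_minima f u v"
      unfolding abs_minima_def local_min_01_def using assms by (auto intro: exI[of _ 1])
    then show False using finite_minima[of u v] infinite_Ioo[OF assms(2)] finite_subset by blast
  qed
  then obtain x where x: "x \<in> {u<..<v}" "f x \<noteq> 0" by blast
  obtain c where "u < pt c" "pt c < v" "\<bar>f (pt c) - f x\<bar> < \<bar>f x\<bar>"
    using near_pt[OF assms, of x "\<bar>f x\<bar>"] x by auto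
  then show thesis by (intro that[of c]) auto
qed

lemma half_power_less:
  assumes "0 < (e :: real)"
  obtains t where "(1/2) ^ t < e"
  using real_arch_pow_inv[OF assms, of "1/2"] by auto

text \<open>If the endpoints \<open>u s\<close> converge to a nonzero of \<open>f\<close>, one fixed command
  eventually moves all of them beyond their limit.\<close>
lemma clear_eventually:
  assumes "(\<lambda>s. pt (u s)) \<longlonglongrightarrow> l" "l \<in> {0..1}" "f l \<noteq> 0" "y \<in> {0..1}" "y \<noteq> l"
  obtains t c where "pt c \<in> {min l y<..<max l y}" "eventually (\<lambda>s. clear p t (u s) c) sequentially"
proof -
  have "0 < \<bar>f l\<bar> / 4" using assms by simp
  then obtain t where t: "(1/2) ^ t < \<bar>f l\<bar> / 4" using half_power_less by blast
  define P where "P = rat_poly_of_code (p t)"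
  define L where "L = poly_lip (p t)"
  have L: "L \<ge> 0" by (simp add: L_def poly_lip_nonneg)
  have P: "2 * (1/2) ^ t < \<bar>P l\<bar>" using approx[OF assms(2), of t] t by (auto simp: P_def)
  \<comment> \<open>Within distance \<open>r\<close> of \<open>l\<close> the Lipschitz term is at
    most \<open>(1/2) ^ t\<close>; the summand 1 avoids division by zero.\<close>
  define r where "r = (1/2) ^ t / (L + 1)"
  have r: "r > 0" using L by (simp add: r_def)
  have "max (min l y) (l - r) < min (max l y) (l + r)" "0 \<le> max (min l y) (l - r)"
    using assms r by auto
  then obtain c where c: "max (min l y) (l - r) < pt c" "pt c < min (max l y) (l + r)"
    using pt_dense by metis
  then have "\<bar>pt c - l\<bar> \<le> r" by auto
  then have "L * \<bar>pt c - l\<bar> \<le> L * r" using L by (rule mult_left_mono)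
  also have "\<dots> \<le> (L + 1) * r" using r by simp
  also have "\<dots> = (1/2) ^ t" using L by (simp add: r_def)
  finally have "(1/2) ^ t + L * \<bar>pt c - l\<bar> - \<bar>P l\<bar> < 0" using P by simp
  \<comment> \<open>The inequality of \<open>clear\<close> is strict at the limit and continuous in
    the moving endpoint, so it holds from some stage on.\<close>
  moreover have "(\<lambda>s. (1/2) ^ t + L * \<bar>pt c - pt (u s)\<bar> - \<bar>P (pt (u s))\<bar>)
      \<longlonglongrightarrow> (1/2) ^ t + L * \<bar>pt c - l\<bar> - \<bar>P l\<bar>"
    unfolding P_def rat_poly_of_code_def Let_def by (intro tendsto_intros assms(1))
  ultimately have "eventually (\<lambda>s. (1/2) ^ t + L * \<bar>pt c - pt (u s)\<bar> - \<bar>P (pt (u s))\<bar> < 0) sequentially"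
    by (rule order_tendstoD(2)[rotated])
  then have "eventually (\<lambda>s. clear p t (u s) c) sequentially"
    by eventually_elim (simp add: clear_def val_def P_def L_def)
  with c show thesis by (intro that[of c t]) auto
qed

text \<open>Between two zeros there is a point \<open>c\<close> where \<open>f\<close> is nonzero,
  and \<open>|f|\<close> is tiny at suitable points near the zeros. Since \<open>A\<close>,
  \<open>c\<close> and \<open>B\<close> are nonzeros, this gives the two valleys. The witnesses do
  not depend on \<open>a'\<close> and \<open>b'\<close>.\<close>

lemma splits_exists:
  assumes "inv A B a b" "f u = 0" "f v = 0" "pt a \<le> u" "u < v" "v \<le> pt b"
  obtains t c q q' where "u < pt c" "pt c < v"
    "\<And>a' b'. pt a' \<le> u \<Longrightarrow> v \<le> pt b' \<Longrightarrow> splits p (tup 0 t c q q') A B a' b'"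
proof -
  have AB: "pt A \<le> pt a" "pt b \<le> pt B" "pt B \<le> 1" "pt a \<le> pt b" "f (pt A) \<noteq> 0" "f (pt B) \<noteq> 0"
    using assms(1) by (auto simp: inv_def)
  have uv: "pt A < u" "v < pt B" "0 \<le> u" "v \<le> 1"
    using assms AB by (auto simp: less_le intro: order_trans[OF pt_nonneg])
  obtain c where c: "u < pt c" "pt c < v" "f (pt c) \<noteq> 0"
    using nonzero_pt[OF uv(3) assms(5) uv(4)] by blast
  \<comment> \<open>The points near the zeros get heights below \<open>d\<close>, the other three
    have heights at least \<open>2 * d\<close>; a gap of \<open>d\<close> is then visible at any
    precision with \<open>4 * (1/2) ^ t < d\<close>.\<close>
  define d where "d = Min {\<bar>f (pt A)\<bar>, \<bar>f (pt B)\<bar>, \<bar>f (pt c)\<bar>} / 2"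
  have d: "d > 0" "2 * d \<le> \<bar>f (pt A)\<bar>" "2 * d \<le> \<bar>f (pt B)\<bar>" "2 * d \<le> \<bar>f (pt c)\<bar>"
    using AB c by (auto simp: d_def)
  obtain q where q: "pt A < pt q" "pt q < pt c" "\<bar>f (pt q) - f u\<bar> < d"
    using near_pt[of "pt A" "pt c" u d] d uv c by auto
  obtain q' where q': "pt c < pt q'" "pt q' < pt B" "\<bar>f (pt q') - f v\<bar> < d"
    using near_pt[of "pt c" "pt B" v d] d uv c AB by auto
  obtain t where t: "(1/2) ^ t < d / 4" using half_power_less[of "d / 4"] d by auto
  have le1: "pt A \<le> 1" "pt q \<le> 1" "pt c \<le> 1" "pt q' \<le> 1" "pt B \<le> 1"
    using q q' c AB by linarith+
  have "smaller p t k l" if "\<bar>f (pt k)\<bar> < d" "2 * d \<le> \<bar>f (pt l)\<bar>" "pt k \<le> 1" "pt l \<le> 1" for k l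
    using that t by (intro less_imp_smaller) linarith+
  then have "smaller p t q A" "smaller p t q c" "smaller p t q' c" "smaller p t q' B"
    using q(3) q'(3) d le1 assms(2,3) by simp_all
  then have "splits p (tup 0 t c q q') A B a' b'" if "pt a' \<le> u" "v \<le> pt b'" for a' b'
    using that c(1,2) q(1,2) q'(1,2) by (simp add: splits_def)
  with c show thesis by (intro that) auto
qed

text \<open>Once the potential is minimal, no split occurs and \<open>A\<close>, \<open>B\<close>
  are frozen. If the endpoints had distinct limits, both limits would be zeros, as otherwise a
  recurring command would move an endpoint past its limit. Two zeros in turn would justify a
  split.\<close>

lemma run_length_tendsto_0:
  "(\<lambda>s. pt (c3 (run p w s)) - pt (c2 (run p w s))) \<longlonglongrightarrow> 0"
proof -
  define A B a b where "A s = c0 (run p w s)" and "B s = c1 (run p w s)"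
    and "a s = c2 (run p w s)" and "b s = c3 (run p w s)" for s
  note defs = A_def B_def a_def b_def
  have inv: "inv (A s) (B s) (a s) (b s)" for s using good_run[of w s] by (simp add: good_def defs)
  have unit: "pt (a s) \<le> pt (b s)" "pt (b s) \<le> 1" for s using run_in_unit[of w s] by (auto simp: defs)
  define pot where "pot s = card (abs_minima f (pt (A s)) (pt (B s)))" for s
  have pot_le: "pot (Suc s) \<le> pot s" for s
    using good_step(4)[OF good_run] by (simp add: pot_def defs)
  obtain S where S: "\<And>s. pot S \<le> pot s"
    using ex_has_least_nat[of "\<lambda>_. True" 0 pot] by blast
  have no_split: "\<not> splits p (pfst s) (A s) (B s) (a s) (b s)" if "s \<ge> S" for s
  proof
    assume "splits p (pfst s) (A s) (B s) (a s) (b s)"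
    then have "pot (Suc s) < pot s"
      using good_step(5)[OF good_run] by (simp add: pot_def defs)
    moreover have "pot s \<le> pot S"
      using that pot_le by (rule lift_Suc_antimono_le[rotated])
    ultimately show False using S[of "Suc s"] by simp
  qed
  have frame: "A s = A S \<and> B s = B S" if "s \<ge> S" for s
    using that
  proof (induction rule: dec_induct)
    case (step s)
    then show ?case using no_split[of s] by (simp add: defs step_def)
  qed simp
  obtain la where la: "(\<lambda>s. pt (a s)) \<longlonglongrightarrow> la" "\<And>s. pt (a s) \<le> la"
  proof (rule tendsto_bounded_mono[of "\<lambda>s. pt (a s)" 1])
    show "pt (a s) \<le> pt (a (Suc s))" for s unfolding a_def by (rule run_left_mono) simp
    show "pt (a s) \<le> 1" for s using unit[of s] by linarith
  qed (rule that)
  obtain lb where lb: "(\<lambda>s. - pt (b s)) \<longlonglongrightarrow> - lb" "\<And>s. lb \<le> pt (b s)"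
  proof -
    obtain l where "(\<lambda>s. - pt (b s)) \<longlonglongrightarrow> l" "\<And>s. - pt (b s) \<le> l"
    proof (rule tendsto_bounded_mono[of "\<lambda>s. - pt (b s)" 0])
      show "- pt (b s) \<le> - pt (b (Suc s))" for s
        unfolding b_def neg_le_iff_le by (rule run_right_antimono) simp
    qed (simp, rule that)
    then show thesis by (intro that[of "- l"]) (auto simp: minus_le_iff)
  qed
  have lb': "(\<lambda>s. pt (b s)) \<longlonglongrightarrow> lb" using tendsto_minus[OF lb(1)] by simp
  have "la \<le> lb" using LIMSEQ_le[OF la(1) lb'] unit by blast
  moreover have "\<not> la < lb"
  proof
    assume less: "la < lb"
    have l01: "la \<in> {0..1}" "lb \<in> {0..1}"
      using less la(2)[of 0] lb(2)[of 0] unit[of 0] order_trans[OF pt_nonneg[of "a 0"] la(2)[of 0]]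
      by auto
    have "f la = 0"
    proof (rule ccontr)
      assume "f la \<noteq> 0"
      then obtain t c where "pt c \<in> {min la lb<..<max la lb}" and
        ev: "eventually (\<lambda>s. clear p t (a s) c) sequentially"
        using clear_eventually[OF la(1) l01(1) _ l01(2)] less by (metis less_irrefl)
      then have c: "pt c \<in> {la<..<lb}" using less by simp
      obtain S' where S': "\<And>s. s \<ge> S' \<Longrightarrow> clear p t (a s) c"
        using ev unfolding eventually_sequentially by blast
      \<comment> \<open>A pair code is at least its second component, so this stage issues the
        wanted command and lies past both \<open>S\<close> and \<open>S'\<close>.\<close>
      define s where "s = prod_encode (tup 1 t c 0 0, max S S')"
      have "s \<ge> max S S'" unfolding s_def by (rule le_prod_encode_2)
      then have "moves p (pfst s) (a s) (b s) (a s)"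
        using S'[of s] c la(2)[of s] lb(2)[of s] by (auto simp: moves_def s_def)
      moreover have "\<not> splits p (pfst s) (A s) (B s) (a s) (b s)"
        using \<open>s \<ge> max S S'\<close> by (intro no_split) simp
      ultimately have "a (Suc s) = c" by (simp add: defs step_def s_def)
      with la(2)[of "Suc s"] c show False by simp
    qed
    moreover have "f lb = 0"
    proof (rule ccontr)
      assume "f lb \<noteq> 0"
      then obtain t c where "pt c \<in> {min lb la<..<max lb la}" and
        ev: "eventually (\<lambda>s. clear p t (b s) c) sequentially"
        using clear_eventually[OF lb' l01(2) _ l01(1)] less by (metis less_irrefl)
      then have c: "pt c \<in> {la<..<lb}" using less by simp
      obtain S' where S': "\<And>s. s \<ge> S' \<Longrightarrow> clear p t (b s) c"
        using ev unfolding eventually_sequentially by blast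
      define s where "s = prod_encode (tup 2 t c 0 0, max S S')"
      have "s \<ge> max S S'" unfolding s_def by (rule le_prod_encode_2)
      then have "moves p (pfst s) (a s) (b s) (b s)"
        using S'[of s] c la(2)[of s] lb(2)[of s] by (auto simp: moves_def s_def)
      moreover have "\<not> splits p (pfst s) (A s) (B s) (a s) (b s)"
        using \<open>s \<ge> max S S'\<close> by (intro no_split) simp
      ultimately have "b (Suc s) = c" by (simp add: defs step_def s_def)
      with lb(2)[of "Suc s"] c show False by simp
    qed
    ultimately obtain t c q q' where
      sp: "\<And>a' b'. pt a' \<le> la \<Longrightarrow> lb \<le> pt b' \<Longrightarrow> splits p (tup 0 t c q q') (A S) (B S) a' b'"
      using splits_exists[OF inv[of S], of la lb] less la(2) lb(2) by metis
    \<comment> \<open>A stage past \<open>S\<close> issuing the splitting command; \<open>A\<close>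
      and \<open>B\<close> are still those of stage \<open>S\<close>, so the command is
      justified.\<close>
    define s where "s = prod_encode (tup 0 t c q q', S)"
    have "s \<ge> S" unfolding s_def by (rule le_prod_encode_2)
    then show False
      using no_split[of s] frame[of s] sp[OF la(2) lb(2), of s s] by (simp add: s_def)
  qed
  ultimately have "la = lb" by simp
  with tendsto_diff[OF lb' la(1)] show ?thesis by (simp add: defs)
qed

section \<open>Every zero is the limit of some search\<close>

definition limit :: "nat \<Rightarrow> real" where
  "limit w = lim (\<lambda>s. pt (c2 (run p w s)))"

lemma limit_bounds: "pt (c2 (run p w s)) \<le> limit w" "limit w \<le> pt (c3 (run p w s))"
proof -
  obtain l where l: "(\<lambda>s. pt (c2 (run p w s))) \<longlonglongrightarrow> l" "\<And>s. pt (c2 (run p w s)) \<le> l"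
  proof (rule tendsto_bounded_mono[of "\<lambda>s. pt (c2 (run p w s))" 1])
    show "pt (c2 (run p w s)) \<le> pt (c2 (run p w (Suc s)))" for s by (rule run_left_mono) simp
    show "pt (c2 (run p w s)) \<le> 1" for s using run_in_unit[of w s] by linarith
  qed (rule that)
  have "limit w = l" unfolding limit_def using l(1) by (rule limI)
  with l(2) show "pt (c2 (run p w s)) \<le> limit w" by simp
  have "pt (c2 (run p w s')) \<le> pt (c3 (run p w s))" if "s' \<ge> s" for s'
    using run_right_antimono[OF that, of w] run_in_unit[of w s'] by linarith
  with \<open>limit w = l\<close> show "limit w \<le> pt (c3 (run p w s))"
    using LIMSEQ_le_const2[OF l(1)] by blast
qed

lemma limit_unique:
  assumes "\<And>s. z \<in> {pt (c2 (run p w s))..pt (c3 (run p w s))}"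
  shows "limit w = z"
proof -
  have "\<bar>limit w - z\<bar> \<le> pt (c3 (run p w s)) - pt (c2 (run p w s))" for s
    using assms[of s] limit_bounds[of w s] by auto
  then have "\<bar>limit w - z\<bar> \<le> 0"
    using LIMSEQ_le_const[OF run_length_tendsto_0[of w]] by blast
  then show ?thesis by simp
qed

text \<open>Unlike \<open>run\<close>, this peels off the first step and allows any initial state,
  as an induction that consumes the leading choice requires.\<close>

primrec iter :: "nat \<Rightarrow> nat \<Rightarrow> nat \<Rightarrow> nat" where
  "iter 0 s x = x"
| "iter (Suc d) s x = iter d (Suc s) (step p (pfst s) x)"

lemma iter_Suc_right: "iter (Suc d) s x = step p (pfst (s + d)) (iter d s x)"
proof (induction d arbitrary: s x)
  case (Suc d)
  show ?case using Suc[of "Suc s" "step p (pfst s) x"] by simp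
qed simp

lemma run_eq_iter: "run p w s = iter s 0 (start w)"
  by (induction s) (simp_all add: iter_Suc_right del: iter.simps(2))

text \<open>Choose the digits so that each split keeps the half containing \<open>z\<close>. A split
  consumes one digit and lowers the number of local minima of \<open>|f|\<close>, so
  \<open>v\<close> digits suffice for any number \<open>d\<close> of steps.\<close>

lemma iter_covers:
  assumes "inv A B a b" "card (abs_minima f (pt A) (pt B)) \<le> v" "pt a \<le> z" "z \<le> pt b" "f z = 0"
  shows "\<exists>w<2 ^ v. z \<in> {pt (c2 (iter d s (tup A B a b w)))..pt (c3 (iter d s (tup A B a b w)))}"
  using assms
proof (induction d arbitrary: s A B a b v)
  case 0
  then show ?case by (auto intro: exI[of _ 0])
next
  case (Suc d)
  define e where "e = pfst s"
  note inv = \<open>inv A B a b\<close>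
  show ?case
  proof (cases "splits p e A B a b")
    case True
    note cards = splits_card[OF inv True]
    from cards(1) Suc.prems(2) obtain v' where v: "v = Suc v'" by (cases v) auto
    show ?thesis
    proof (cases "z \<le> pt (c2 e)")
      case z: True
      obtain w where w: "w < 2 ^ v'" "z \<in> {pt (c2 (iter d (Suc s) (tup A (c2 e) a (c2 e) w)))..
          pt (c3 (iter d (Suc s) (tup A (c2 e) a (c2 e) w)))}"
        using Suc.IH[OF splits_inv(1)[OF inv True], of v' "Suc s"] cards(1) Suc.prems z v by auto
      \<comment> \<open>The lowest digit is read first, and digit 0 keeps the left half; so the word
        for the half is doubled.\<close>
      have "step p e (tup A B a b (2 * w)) = tup A (c2 e) a (c2 e) w"
        using True by (simp add: step_def)
      with w v show ?thesis by (intro exI[of _ "2 * w"]) (simp add: e_def)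
    next
      case z: False
      obtain w where w: "w < 2 ^ v'" "z \<in> {pt (c2 (iter d (Suc s) (tup (c2 e) B (c2 e) b w)))..
          pt (c3 (iter d (Suc s) (tup (c2 e) B (c2 e) b w)))}"
        using Suc.IH[OF splits_inv(2)[OF inv True], of v' "Suc s"] cards(2) Suc.prems z v by auto
      have "step p e (tup A B a b (2 * w + 1)) = tup (c2 e) B (c2 e) b w"
        using True by (simp add: step_def)
      with w v show ?thesis by (intro exI[of _ "2 * w + 1"]) (simp add: e_def)
    qed
  next
    case False
    consider (l) "c0 e = 1" "moves p e a b a" | (r) "c0 e = 2" "moves p e a b b"
      | (n) "\<not> (c0 e = 1 \<and> moves p e a b a)" "\<not> (c0 e = 2 \<and> moves p e a b b)" by blast
    then show ?thesis
    proof cases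
      case l
      note i = moves_left_inv[OF inv l(2)]
      \<comment> \<open>The range skipped by the move belongs to the zero-free part in the new
        invariant.\<close>
      have "pt (c2 e) \<le> z"
      proof (rule ccontr)
        assume "\<not> pt (c2 e) \<le> z"
        with i Suc.prems show False using inv by (auto simp: inv_def)
      qed
      with Suc.IH[OF i Suc.prems(2), of "Suc s"] Suc.prems l False show ?thesis
        by (simp add: step_def e_def[symmetric])
    next
      case r
      note i = moves_right_inv[OF inv r(2)]
      have "z \<le> pt (c2 e)"
      proof (rule ccontr)
        assume "\<not> z \<le> pt (c2 e)"
        with i Suc.prems show False using inv by (auto simp: inv_def)
      qed
      with Suc.IH[OF i Suc.prems(2), of "Suc s"] Suc.prems r False show ?thesis
        by (simp add: step_def e_def[symmetric])
    next
      case n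
      with Suc.IH[OF Suc.prems, of "Suc s"] False show ?thesis
        by (auto simp: step_def e_def[symmetric])
    qed
  qed
qed

text \<open>At each stage some word captures \<open>z\<close>, but the word may depend on the stage.
  As there are finitely many words and the intervals are nested, one word works for all
  stages.\<close>

lemma zero_is_limit:
  assumes "z \<in> {0..1}" "f z = 0"
  shows "\<exists>w<2 ^ (2 * (n + 1)). limit w = z"
proof -
  let ?K = "2 ^ (2 * (n + 1)) :: nat"
  let ?I = "\<lambda>w s. {pt (c2 (run p w s))..pt (c3 (run p w s))}"
  have "inv 0 (prod_encode (1, 0)) 0 (prod_encode (1, 0))"
    using good_run[of 0 0] by (simp add: good_def start_def)
  then have cover: "\<exists>w<?K. z \<in> ?I w s" for s
    unfolding run_eq_iter start_def
    using iter_covers[of 0 "prod_encode (1, 0)" 0 "prod_encode (1, 0)" "2 * (n + 1)" z s 0]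
      assms card_minima by simp
  have "\<exists>w<?K. \<forall>s. z \<in> ?I w s"
  proof (rule ccontr)
    assume "\<not> (\<exists>w<?K. \<forall>s. z \<in> ?I w s)"
    then obtain r where r: "\<And>w. w < ?K \<Longrightarrow> z \<notin> ?I w (r w)" by metis
    \<comment> \<open>If every word \<open>w\<close> lost \<open>z\<close> at some stage
      \<open>r w\<close>, then all of them would have lost it at the maximum of these
      stages.\<close>
    obtain w where w: "w < ?K" "z \<in> ?I w (Max (r ` {..<?K}))" using cover by blast
    have "r w \<le> Max (r ` {..<?K})" using w(1) by (intro Max_ge) auto
    with w(2) have "z \<in> ?I w (r w)"
      using run_left_mono run_right_antimono by (meson atLeastAtMost_iff order_trans)
    with r w(1) show False by blast
  qed
  then show ?thesis using limit_unique by blast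
qed

end

section \<open>The machine computing all zeros\<close>

lemma rat_of_code_pt: "rat_of_code (prod_encode (2 * pfst k, psnd k)) = pt k"
  by (simp add: rat_of_code_def pt_def int_decode_def sum_decode_def)

theorem theorem47:
  shows "\<exists>\<kappa>. computable_nat_fun \<kappa> \<and>
    (\<forall>n. computable_mv cfun_rep (cauchy_rep_cube (\<kappa> n)) (zero_nmin_dom n) (zero_nmin (\<kappa> n)))"
proof -
  \<comment> \<open>The number of binary words of length \<open>2 * (n + 1)\<close>, the bound on
    the number of local minima of \<open>|f|\<close>.\<close>
  define \<kappa> :: "nat \<Rightarrow> nat" where "\<kappa> n = 2 ^ (2 * (n + 1))" for n
  have "cmp (\<lambda>p n. \<kappa> n)" unfolding \<kappa>_def by (intro cmp_arith)
  then have \<kappa>: "computable_nat_fun \<kappa>" unfolding cmp_def computable_nat_fun_def by blast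
  \<comment> \<open>Here \<open>z\<close> codes \<open>((i, m), s)\<close>: the word
    \<open>i\<close> of the search, the requested precision \<open>m\<close> and the stage
    \<open>s\<close>.\<close>
  define state where "state p z = run p (pfst (pfst z)) (psnd z)" for p z
  define test :: "(nat \<Rightarrow> nat) \<Rightarrow> nat \<Rightarrow> nat" where
    "test p z = (if pt (c3 (state p z)) - pt (c2 (state p z)) \<le> (1/2) ^ psnd (pfst z) then 0 else 1)"
    for p z
  \<comment> \<open>Doubling the numerator encodes it as a nonnegative integer for
    \<open>rat_of_code\<close>.\<close>
  define out where "out p z = prod_encode (2 * pfst (c2 (state p z)), psnd (c2 (state p z)))" for p z
  have state: "cmp state" unfolding state_def by (intro cmp_run cmp_arith)
  have "cmp test" unfolding test_def
    by (intro cmp_if dcmp_rle rcmp_diff rcmp_pt rcmp_half_power cmp_tup state cmp_arith)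
  moreover have "cmp out" unfolding out_def by (intro cmp_arith cmp_tup state)
  ultimately obtain e where e: "\<And>p. (\<And>x. \<exists>s. test p (prod_encode (x, s)) = 0) \<Longrightarrow>
    (\<forall>x. rf_eval p e x (out p (prod_encode (x, LEAST s. test p (prod_encode (x, s)) = 0))))"
    using cmp_minimization[of test out] by blast
  have "\<exists>q. (\<forall>k. rf_eval p e k (q k)) \<and> (\<exists>y. y \<in> zero_nmin (\<kappa> n) f \<and> cauchy_rep_cube (\<kappa> n) q y)"
    if "f \<in> zero_nmin_dom n" "cfun_rep p f" for n p f
  proof -
    interpret zero_search p f n using that by unfold_locales
    have ex: "\<exists>s. test p (prod_encode (x, s)) = 0" for x
    proof -
      have "eventually (\<lambda>s. pt (c3 (run p (pfst x) s)) - pt (c2 (run p (pfst x) s)) < (1/2) ^ psnd x)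
          sequentially"
        by (rule order_tendstoD(2)[OF run_length_tendsto_0]) simp
      then obtain s where "pt (c3 (run p (pfst x) s)) - pt (c2 (run p (pfst x) s)) < (1/2) ^ psnd x"
        by (auto simp: eventually_sequentially)
      then show ?thesis by (intro exI[of _ s]) (simp add: test_def state_def)
    qed
    define st where "st x = (LEAST s. test p (prod_encode (x, s)) = 0)" for x
    define q where "q x = out p (prod_encode (x, st x))" for x
    define y where "y = map limit [0..<\<kappa> n]"
    have "rf_eval p e k (q k)" for k
      using e[OF ex] by (simp add: q_def st_def)
    moreover have unit: "limit w \<in> {0..1}" for w
      using order_trans[OF pt_nonneg limit_bounds(1)] order_trans[OF limit_bounds(2) run_in_unit(2)]
      by simp
    have "y \<in> zero_nmin (\<kappa> n) f"
      using zero_is_limit unit by (fastforce simp: zero_nmin_def y_def \<kappa>_def)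
    moreover have "\<bar>rat_of_code (q (prod_encode (i, m))) - limit i\<bar> \<le> (1/2) ^ m" for i m
    proof -
      define x where "x = prod_encode (i, m)"
      have "test p (prod_encode (x, st x)) = 0"
        unfolding st_def using ex[of x] by (rule LeastI_ex)
      then have "pt (c3 (run p i (st x))) - pt (c2 (run p i (st x))) \<le> (1/2) ^ m"
        by (simp add: test_def state_def x_def split: if_splits)
      moreover have "rat_of_code (q x) = pt (c2 (run p i (st x)))"
        by (simp add: q_def out_def rat_of_code_pt state_def x_def)
      \<comment> \<open>The limit lies in the interval reached at stage \<open>st x\<close>, whose
        length is at most \<open>(1/2) ^ m\<close>; so its left endpoint is close enough.\<close>
      ultimately show ?thesis
        using limit_bounds[of i "st x"] by (simp add: x_def)
    qed
    then have "cauchy_rep_cube (\<kappa> n) q y"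
      using unit by (auto simp: cauchy_rep_cube_def y_def)
    ultimately show ?thesis by blast
  qed
  then have "computable_mv cfun_rep (cauchy_rep_cube (\<kappa> n)) (zero_nmin_dom n) (zero_nmin (\<kappa> n))" for n
    unfolding computable_mv_def by blast
  with \<kappa> show ?thesis by blast
qed

end
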